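(* Let $X$ be a nonempty set, let $G=(G_{l,m})_{l>0,\,m\ge 0}$ be a general position relation on $X$, let $l\ge 0$, and let $a=(a_1,\ldots,a_l)$ be a finite sequence of elements of $X$. Then for every integer $m\ge 0$ with $m\le (|G|-l-1)/2$ (every $m\ge 0$ if $|G|=\infty$), the homology group $H_m(F_G(X;a)_* )$ vanishes.
   Context: **Complex of words.** For a nonempty set $X$ and $n\ge 0$, let $F(X)_n$ be the free abelian group on the set of all words $(x_1,\ldots,x_n)$ of length $n$ with entries in $X$ (equivalently, maps $\{1,\ldots,n\}\to X$); in particular $F(X)_0=\mathbb{Z}$, generated by the empty word. The differential $d:F(X)_n\to F(X)_{n-1}$ for $n\ge 1$ is $$d(x_1,\ldots,x_n)=\sum_{k=1}^n(-1)^{k+1}(x_1,\ldots,x_{k-1},x_{k+1},\ldots,x_n),$$ and $d=0$ on $F(X)_0$. **General position relation.** For all $l>0$, $m\ge 0$ let $G_{l,m}$ be a relation in $l+m$ variables from $X$, written $G_{l,m}(x;y)$ for sequences $x$ of length $l$ and $y$ of length $m$. The family $G=(G_{l,m})$ is called a general position relation if for all finite sequences $x,y,z$ of elements of $X$ of lengths $l,m,n$ respectively (such that all relations involved are defined, i.e. the first index is positive): (i) each $G_{l,m}$ is symmetric in its first $l$ arguments and symmetric in its last $m$ arguments (invariant under permuting the first $l$ arguments among themselves and the last $m$ arguments among themselves); (ii) if $G_{l+m,n}(x,y;z)$ then $G_{l,m+n}(x;y,z)$; and if $G_{l,m+n}(x;y,z)$ then $G_{l,n}(x;z)$; (iii)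 if $G_{l,m+n}(x;y,z)$ and $G_{m,n}(y;z)$ then $G_{l+m,n}(x,y;z)$. Here commas denote concatenation of sequences. We say that $x$ is in $G$-general position to $y$ iff $G_{l,m}(x;y)$; the empty sequence ($l=0$) is regarded as being in $G$-general position to every $y$. **Complex of words in general position.** For a finite sequence $b$ of elements of $X$, $F_G(X;b)_n\subseteq F(X)_n$ is the subgroup of chains all of whose terms are in $G$-general position to $b$, i.e. the free abelian group generated by the words of length $n$ that are in $G$-general position to $b$. In particular $F_G(X;b)_0=\mathbb{Z}$. By axioms (i) and (ii) these form a subcomplex $F_G(X;b)_*$ of $F(X)_*$. The group $H_m(F_G(X;b)_* )$ is its homology in degree $m$; since $d=0$ on degree $0$, $H_0$ is the cokernel of $d:F_G(X;b)_1\to\mathbb{Z}$. **The invariant $|G|$.** $|G|$ is the smallest natural number $n\ge 0$ such that there is a sequence $x$ of elements of $X$ of length $n$ for which there is no element of $X$ that is in $G$-general position to $x$ (a single element being regarded as a sequence of length $1$). If no such $n$ exists, $|G|=\infty$. *)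

theory Defs
  imports "HOL-Algebra.Free_Abelian_Groups" "HOL-Library.Multiset" "HOL-Library.Extended_Real"
begin

text \<open>Words over \<open>X\<close> are lists \<open>w\<close> with \<open>set w \<subseteq> X\<close>.  A family of relations \<open>G\<^sub>l\<^sub>,\<^sub>m\<close> is encoded as a single
  binary relation on lists, the indices being the lengths of the two arguments.  The value of \<open>G\<close> on an
  empty first argument (\<open>l = 0\<close>) or on lists with entries outside \<open>X\<close> is junk: it is
  neither constrained by the axioms nor used anywhere.\<close>

definition general_position_relation :: "'a set \<Rightarrow> ('a list \<Rightarrow> 'a list \<Rightarrow> bool) \<Rightarrow> bool" where
  "general_position_relation X G \<longleftrightarrow>
     (\<forall>x x' y y'. set x \<subseteq> X \<longrightarrow> set y \<subseteq> X \<longrightarrow> x \<noteq> [] \<longrightarrow>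
        mset x' = mset x \<longrightarrow> mset y' = mset y \<longrightarrow> G x y \<longrightarrow> G x' y') \<and>
     (\<forall>x y z. set x \<subseteq> X \<longrightarrow> set y \<subseteq> X \<longrightarrow> set z \<subseteq> X \<longrightarrow> x \<noteq> [] \<longrightarrow>
        G (x @ y) z \<longrightarrow> G x (y @ z)) \<and>
     (\<forall>x y z. set x \<subseteq> X \<longrightarrow> set y \<subseteq> X \<longrightarrow> set z \<subseteq> X \<longrightarrow> x \<noteq> [] \<longrightarrow>
        G x (y @ z) \<longrightarrow> G x z) \<and>
     (\<forall>x y z. set x \<subseteq> X \<longrightarrow> set y \<subseteq> X \<longrightarrow> set z \<subseteq> X \<longrightarrow> x \<noteq> [] \<longrightarrow> y \<noteq> [] \<longrightarrow>
        G x (y @ z) \<longrightarrow> G y z \<longrightarrow> G (x @ y) z)"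

definition in_general_position :: "('a list \<Rightarrow> 'a list \<Rightarrow> bool) \<Rightarrow> 'a list \<Rightarrow> 'a list \<Rightarrow> bool" where
  "in_general_position G x y \<longleftrightarrow> x = [] \<or> G x y"

text \<open>The infimum in \<^typ>\<open>enat\<close> is the least element of a nonempty set, and \<open>\<infinity>\<close> for the empty set.\<close>

definition gp_size :: "'a set \<Rightarrow> ('a list \<Rightarrow> 'a list \<Rightarrow> bool) \<Rightarrow> enat" where
  "gp_size X G =
     Inf {enat (length x) | x. set x \<subseteq> X \<and> \<not> (\<exists>e\<in>X. in_general_position G [e] x)}"

text \<open>Positions in a list start at 0, so deleting position \<open>k\<close> carries the sign \<open>(-1)^k\<close>;
  on the empty word the sum is empty, so the differential vanishes in degree 0.\<close>

definition word_differential :: "('a list \<Rightarrow>\<^sub>0 int) \<Rightarrow> ('a list \<Rightarrow>\<^sub>0 int)" where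
  "word_differential =
     frag_extend (\<lambda>w. \<Sum>k<length w. frag_cmul ((-1) ^ k) (frag_of (take k w @ drop (Suc k) w)))"

definition gp_words :: "'a set \<Rightarrow> ('a list \<Rightarrow> 'a list \<Rightarrow> bool) \<Rightarrow> 'a list \<Rightarrow> nat \<Rightarrow> 'a list set" where
  "gp_words X G b n = {w. set w \<subseteq> X \<and> length w = n \<and> in_general_position G w b}"

definition gp_chain_group ::
    "'a set \<Rightarrow> ('a list \<Rightarrow> 'a list \<Rightarrow> bool) \<Rightarrow> 'a list \<Rightarrow> nat \<Rightarrow> ('a list \<Rightarrow>\<^sub>0 int) monoid" where
  "gp_chain_group X G b n = free_Abelian_group (gp_words X G b n)"

definition gp_cycles ::
    "'a set \<Rightarrow> ('a list \<Rightarrow> 'a list \<Rightarrow> bool) \<Rightarrow> 'a list \<Rightarrow> nat \<Rightarrow> ('a list \<Rightarrow>\<^sub>0 int) set" where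
  "gp_cycles X G b n = {c \<in> carrier (gp_chain_group X G b n). word_differential c = 0}"

definition gp_boundaries ::
    "'a set \<Rightarrow> ('a list \<Rightarrow> 'a list \<Rightarrow> bool) \<Rightarrow> 'a list \<Rightarrow> nat \<Rightarrow> ('a list \<Rightarrow>\<^sub>0 int) set" where
  "gp_boundaries X G b n = word_differential ` carrier (gp_chain_group X G b (Suc n))"

definition gp_homology_group ::
    "'a set \<Rightarrow> ('a list \<Rightarrow> 'a list \<Rightarrow> bool) \<Rightarrow> 'a list \<Rightarrow> nat \<Rightarrow> ('a list \<Rightarrow>\<^sub>0 int) set monoid" where
  "gp_homology_group X G b n =
     subgroup_generated (gp_chain_group X G b n) (gp_cycles X G b n) Mod gp_boundaries X G b n"

end

theory Submission
  imports Defs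
begin

text \<open>Induction on \<open>m\<close>.  Choose \<open>e\<close> in general position to \<open>a\<close>; prepending \<open>e\<close> contracts the subcomplex
  \<open>F\<^sub>G(X;e,a)\<close> inside \<open>F\<^sub>G(X;a)\<close>, so it suffices to move every \<open>m\<close>-cycle of \<open>F\<^sub>G(X;a)\<close> into
  \<open>F\<^sub>G(X;e,a)\<close>.  Filter \<open>F\<^sub>G(X;a)\<close> by the subcomplexes \<open>T\<^sub>i\<close> spanned by the words \<open>uv\<close> with \<open>u\<close> of length
  at most \<open>i\<close> and \<open>v\<close> in general position to \<open>u,e,a\<close>.  Then \<open>T\<^sub>0 = F\<^sub>G(X;e,a)\<close>, while \<open>T\<^sub>m\<close> is everything
  in degree \<open>m\<close>.  A word \<open>uv\<close> of \<open>T\<^sub>i\<close> with \<open>u\<close> of length \<open>i\<close> lies in \<open>T\<^bsub>i-1\<^esub>\<close> iff the last letter of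
  \<open>u\<close> is in general position to \<open>e,a\<close> and the other letters of \<open>u\<close>.  As this depends on \<open>u\<close> only,
  \<open>T\<^sub>i / T\<^bsub>i-1\<^esub>\<close> is a direct sum of copies of \<open>F\<^sub>G(X;u,e,a)\<close> shifted by \<open>i\<close>.  Its homology in degree
  \<open>m\<close> vanishes by the induction hypothesis: the degree drops by \<open>i \<ge> 1\<close> and the length of \<open>a\<close> grows
  by \<open>i + 1 \<le> 2i\<close>.\<close>

section \<open>The differential on words\<close>

lemma frag_cmul_diff_right: "frag_cmul k (c - c') = frag_cmul k c - frag_cmul k c'"
  by (rule poly_mapping_eqI) (simp add: lookup_minus right_diff_distrib)

lemma word_differential_0 [simp]: "word_differential 0 = 0"
  by (simp add: word_differential_def)

lemma word_differential_diff:
  "word_differential (c - c') = word_differential c - word_differential c'"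
  by (simp add: word_differential_def frag_extend_diff)

lemma word_differential_add:
  "word_differential (c + c') = word_differential c + word_differential c'"
  by (simp add: word_differential_def frag_extend_add)

lemma word_differential_cmul:
  "word_differential (frag_cmul k c) = frag_cmul k (word_differential c)"
  by (simp add: word_differential_def frag_extend_cmul)

lemma word_differential_sum:
  "finite I \<Longrightarrow> word_differential (\<Sum>i\<in>I. c i) = (\<Sum>i\<in>I. word_differential (c i))"
  by (simp add: word_differential_def frag_extend_sum o_def)

definition prepend :: "'a list \<Rightarrow> ('a list \<Rightarrow>\<^sub>0 int) \<Rightarrow> ('a list \<Rightarrow>\<^sub>0 int)" where
  "prepend u = frag_extend (\<lambda>v. frag_of (u @ v))"

lemma prepend_frag_of [simp]: "prepend u (frag_of v) = frag_of (u @ v)"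
  by (simp add: prepend_def)

lemma prepend_0 [simp]: "prepend u 0 = 0"
  by (simp add: prepend_def)

lemma prepend_diff: "prepend u (c - c') = prepend u c - prepend u c'"
  by (simp add: prepend_def frag_extend_diff)

lemma prepend_cmul: "prepend u (frag_cmul k c) = frag_cmul k (prepend u c)"
  by (simp add: prepend_def frag_extend_cmul)

lemma keys_prepend: "Poly_Mapping.keys (prepend u c) \<subseteq> (@) u ` Poly_Mapping.keys c"
  unfolding prepend_def by (rule order_trans[OF keys_frag_extend]) (auto simp: keys_frag_of)

lemma prepend_append: "prepend u (prepend v c) = prepend (u @ v) c"
proof -
  have "Poly_Mapping.keys c \<subseteq> UNIV" by simp
  then show ?thesis
    by (induction c rule: frag_induction) (simp_all add: prepend_diff)
qed

lemma word_differential_Nil [simp]: "word_differential (frag_of []) = 0"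
  by (simp add: word_differential_def)

text \<open>The first summand deletes \<open>x\<close>; every other deletion sits one position later
  than in \<open>w\<close>, hence the minus sign.\<close>

lemma word_differential_Cons:
  "word_differential (frag_of (x # w)) = frag_of w - prepend [x] (word_differential (frag_of w))"
proof -
  have "prepend [x] (word_differential (frag_of w)) =
      (\<Sum>k<length w. frag_cmul ((-1) ^ k) (frag_of (x # take k w @ drop (Suc k) w)))"
    unfolding word_differential_def prepend_def
    by (simp add: frag_extend_sum frag_extend_cmul o_def)
  then show ?thesis
    by (simp add: word_differential_def sum.lessThan_Suc_shift sum_negf del: sum.lessThan_Suc
        flip: minus_frag_cmul)
qed

text \<open>Prepending a letter is a contracting homotopy of the complex of all words. By linearity
  only single words need checking.\<close>

lemma word_differential_prepend_single:
  "word_differential (prepend [x] c) = c - prepend [x] (word_differential c)"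
proof -
  have "Poly_Mapping.keys c \<subseteq> UNIV" by simp
  then show ?thesis
    by (induction c rule: frag_induction)
      (simp_all add: word_differential_Cons word_differential_diff prepend_diff)
qed

lemma word_differential_square: "word_differential (word_differential c) = 0"
proof -
  have word: "word_differential (word_differential (frag_of w)) = 0" for w :: "'a list"
    by (induction w)
      (simp_all add: word_differential_Cons word_differential_diff word_differential_prepend_single)
  have "Poly_Mapping.keys c \<subseteq> UNIV" by simp
  then show ?thesis
    by (induction c rule: frag_induction) (simp_all add: word word_differential_diff)
qed

lemma keys_word_differential:
  "Poly_Mapping.keys (word_differential c) \<subseteq>
     {take k w @ drop (Suc k) w | k w. w \<in> Poly_Mapping.keys c \<and> k < length w}"
proof -
  have "Poly_Mapping.keys (\<Sum>k<length w. frag_cmul ((-1) ^ k) (frag_of (take k w @ drop (Suc k) w)))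
      \<subseteq> (\<lambda>k. take k w @ drop (Suc k) w) ` {..<length w}" for w :: "'a list"
    by (rule order_trans[OF keys_sum]) (auto simp: keys_frag_of)
  then show ?thesis
    unfolding word_differential_def
    by (intro order_trans[OF keys_frag_extend]) blast
qed

text \<open>A Leibniz rule with error term: deletions in the suffix pass over the letters of
  \<open>u\<close>, which gives the sign. What is left are the deletions inside
  \<open>u\<close>.\<close>

lemma keys_differential_prepend:
  "Poly_Mapping.keys (word_differential (prepend u c) -
      frag_cmul ((-1) ^ length u) (prepend u (word_differential c)))
   \<subseteq> {take k u @ drop (Suc k) u @ v | k v. k < length u \<and> v \<in> Poly_Mapping.keys c}"
proof -
  define R where "R u c = word_differential (prepend u c) -
      frag_cmul ((-1) ^ length u) (prepend u (word_differential c))" for u :: "'a list" and c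
  \<comment> \<open>Only the deletion of \<open>x\<close> is new; in all other terms
    \<open>x\<close> stays in front and the sign flips.\<close>
  have R_Cons: "R (x # u) (frag_of v) = frag_of (u @ v) - prepend [x] (R u (frag_of v))" for x u v
    by (simp add: R_def word_differential_Cons prepend_diff prepend_cmul prepend_append
        flip: minus_frag_cmul)
  have word: "Poly_Mapping.keys (R u (frag_of v)) \<subseteq> {take k u @ drop (Suc k) u @ v | k. k < length u}"
    for u v :: "'a list"
  proof (induction u)
    case Nil
    have "prepend [] c = c" for c :: "'a list \<Rightarrow>\<^sub>0 int"
      by (simp add: prepend_def flip: frag_expansion)
    then show ?case by (simp add: R_def)
  next
    case (Cons x u)
    have "Poly_Mapping.keys (R (x # u) (frag_of v)) \<subseteq>
        {u @ v} \<union> (#) x ` Poly_Mapping.keys (R u (frag_of v))"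
      unfolding R_Cons
      using keys_diff[of "frag_of (u @ v)" "prepend [x] (R u (frag_of v))"]
        keys_prepend[of "[x]" "R u (frag_of v)"]
      by (auto simp: keys_frag_of)
    also have "\<dots> \<subseteq> {take k (x # u) @ drop (Suc k) (x # u) @ v | k. k < length (x # u)}"
    proof -
      have "u @ v \<in> {take k (x # u) @ drop (Suc k) (x # u) @ v | k. k < length (x # u)}"
        by (auto intro!: exI[of _ 0])
      moreover have "x # w \<in> {take k (x # u) @ drop (Suc k) (x # u) @ v | k. k < length (x # u)}"
        if w: "w \<in> Poly_Mapping.keys (R u (frag_of v))" for w
      proof -
        obtain k where "k < length u" "w = take k u @ drop (Suc k) u @ v"
          using w Cons.IH by blast
        then show ?thesis
          by (auto intro!: exI[of _ "Suc k"])
      qed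
      ultimately show ?thesis by blast
    qed
    finally show ?case .
  qed
  \<comment> \<open>\<open>R u\<close> is linear, so the bound on words carries over to
    chains.\<close>
  have "Poly_Mapping.keys c \<subseteq> UNIV" by simp
  then have "R u c = frag_extend (\<lambda>v. R u (frag_of v)) c"
    by (induction c rule: frag_induction)
      (simp_all add: R_def word_differential_diff prepend_diff frag_extend_diff
        frag_cmul_diff_right algebra_simps)
  then show ?thesis
    unfolding R_def[symmetric] using word
    by (auto dest!: subsetD[OF keys_frag_extend]) blast
qed

lemma mset_delete_nth_subset: "mset (take k w @ drop (Suc k) w) \<subseteq># mset w"
proof -
  have "mset w = mset (take k w) + mset (drop k w)"
    by (metis append_take_drop_id mset_append)
  moreover have "drop (Suc k) w = tl (drop k w)"
    by (simp add: drop_Suc tl_drop)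
  then have "mset (drop (Suc k) w) \<subseteq># mset (drop k w)"
    by (cases "drop k w") simp_all
  ultimately show ?thesis by simp
qed

text \<open>For a word \<open>u\<close>, the coefficient \<open>c\<^sub>u\<close> in the decomposition of a chain as a sum of terms \<open>u c\<^sub>u\<close>
  over prefixes \<open>u\<close> of a fixed length.\<close>

definition prefix_coeff :: "'a list \<Rightarrow> ('a list \<Rightarrow>\<^sub>0 int) \<Rightarrow> ('a list \<Rightarrow>\<^sub>0 int)" where
  "prefix_coeff u =
     frag_extend (\<lambda>w. if take (length u) w = u then frag_of (drop (length u) w) else 0)"

lemma prefix_coeff_frag_of:
  "prefix_coeff u (frag_of w) = (if take (length u) w = u then frag_of (drop (length u) w) else 0)"
  by (simp add: prefix_coeff_def)

lemma prefix_coeff_0 [simp]: "prefix_coeff u 0 = 0"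
  by (simp add: prefix_coeff_def)

lemma prefix_coeff_diff: "prefix_coeff u (c - c') = prefix_coeff u c - prefix_coeff u c'"
  by (simp add: prefix_coeff_def frag_extend_diff)

lemma prefix_coeff_cmul: "prefix_coeff u (frag_cmul k c) = frag_cmul k (prefix_coeff u c)"
  by (simp add: prefix_coeff_def frag_extend_cmul)

lemma prefix_coeff_prepend:
  assumes "length u = length u'"
  shows "prefix_coeff u (prepend u' c) = (if u = u' then c else 0)"
proof -
  have "Poly_Mapping.keys c \<subseteq> UNIV" by simp
  then show ?thesis
    by (induction c rule: frag_induction)
      (use assms in \<open>auto simp: prefix_coeff_frag_of prepend_diff prefix_coeff_diff\<close>)
qed

lemma prefix_coeff_eq_0:
  "(\<And>w. w \<in> Poly_Mapping.keys c \<Longrightarrow> take (length u) w \<noteq> u) \<Longrightarrow> prefix_coeff u c = 0"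
  unfolding prefix_coeff_def by (rule frag_extend_eq_0) auto

lemma keys_prefix_coeff:
  "v \<in> Poly_Mapping.keys (prefix_coeff u c) \<Longrightarrow> u @ v \<in> Poly_Mapping.keys c"
  unfolding prefix_coeff_def
  by (drule subsetD[OF keys_frag_extend])
    (auto simp: keys_frag_of split: if_splits, metis append_take_drop_id)


section \<open>Filtering words by general position\<close>

locale general_position =
  fixes X :: "'a set" and G :: "'a list \<Rightarrow> 'a list \<Rightarrow> bool"
  assumes gp_relation: "general_position_relation X G"
begin

abbreviation gp :: "'a list \<Rightarrow> 'a list \<Rightarrow> bool" where
  "gp \<equiv> in_general_position G"

lemma gp_cong_mset:
  assumes "mset x = mset x'" "mset y = mset y'" "set x \<subseteq> X" "set y \<subseteq> X"
  shows "gp x y \<longleftrightarrow> gp x' y'"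
proof -
  have perm: "gp w' z'"
    if "mset w' = mset w" "mset z' = mset z" "set w \<subseteq> X" "set z \<subseteq> X" "gp w z" for w w' z z'
    using gp_relation that unfolding general_position_relation_def in_general_position_def
    by (metis mset_zero_iff)
  have "set x' \<subseteq> X" "set y' \<subseteq> X"
    using assms mset_eq_setD by blast+
  with assms show ?thesis
    using perm[of x' x y' y] perm[of x x' y y'] by auto
qed

text \<open>Axioms (ii) and (iii) merge into one chain rule. They are applied to both
  \<open>x @ y\<close> and \<open>y @ x\<close>, which symmetry identifies; empty words are covered
  by the convention for \<open>l = 0\<close>.\<close>

lemma gp_append:
  assumes "set x \<subseteq> X" "set y \<subseteq> X" "set z \<subseteq> X"
  shows "gp (x @ y) z \<longleftrightarrow> gp x z \<and> gp y (x @ z)"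
proof -
  have rel: "gp x (y @ z) \<and> gp x z" if "gp (x @ y) z" "set x \<subseteq> X" "set y \<subseteq> X" for x y
    using gp_relation that assms(3)
    unfolding general_position_relation_def in_general_position_def
    by (metis append_is_Nil_conv)
  have join: "gp (y @ x) z" if "gp x z" "gp y (x @ z)"
  proof (cases "x = [] \<or> y = []")
    case True
    with that show ?thesis by auto
  next
    case False
    with gp_relation that assms show ?thesis
      unfolding general_position_relation_def in_general_position_def by metis
  qed
  have "gp (x @ y) z \<longleftrightarrow> gp (y @ x) z"
    using assms by (intro gp_cong_mset) auto
  then show ?thesis
    using rel[of x y] rel[of y x] join assms by blast
qed

text \<open>Symmetry moves the discarded letters \<open>r\<close> to the end of the first argument
  and \<open>s\<close> to the front of the second, where the chain rule and axiom (ii) remove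
  them.\<close>

lemma gp_mono:
  assumes "gp x y" "mset x' \<subseteq># mset x" "mset y' \<subseteq># mset y" "set x \<subseteq> X" "set y \<subseteq> X"
  shows "gp x' y'"
proof -
  obtain r s where r: "mset x = mset (x' @ r)" and s: "mset y = mset (s @ y')"
    using assms(2,3) by (metis ex_mset mset_append subset_mset.add_diff_inverse add.commute)
  have sets: "set x' \<subseteq> X" "set r \<subseteq> X" "set s \<subseteq> X" "set y' \<subseteq> X"
    using assms(4,5) mset_eq_setD[OF r] mset_eq_setD[OF s] by auto
  have "gp (x' @ r) (s @ y')"
    using gp_cong_mset[OF r s] assms by blast
  then have "gp x' (s @ y')"
    using gp_append[of x' r "s @ y'"] sets by auto
  then show ?thesis
    using gp_relation sets unfolding general_position_relation_def in_general_position_def by metis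
qed

text \<open>\<open>F_G(X;b)\<close> is a subcomplex, because deleting a letter passes to a
  submultiset.\<close>

lemma keys_differential_gp_words:
  assumes "set b \<subseteq> X" "Poly_Mapping.keys c \<subseteq> gp_words X G b (Suc n)"
  shows "Poly_Mapping.keys (word_differential c) \<subseteq> gp_words X G b n"
proof
  fix w' assume "w' \<in> Poly_Mapping.keys (word_differential c)"
  then obtain k w where w: "w \<in> Poly_Mapping.keys c" "k < length w"
    "w' = take k w @ drop (Suc k) w"
    using keys_word_differential by blast
  then have "mset w' \<subseteq># mset w"
    using mset_delete_nth_subset by metis
  moreover from this have "set w' \<subseteq> set w"
    by (metis set_mset_mono set_mset_mset)
  moreover have "w \<in> gp_words X G b (Suc n)" "length w' = length w - 1"
    using w assms(2) by auto
  ultimately show "w' \<in> gp_words X G b n"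
    using assms(1) gp_mono[of w b w' b] unfolding gp_words_def by auto
qed

section \<open>The filtration and its graded pieces\<close>

text \<open>The words of length \<open>n\<close> spanning \<open>T_i\<close>. The prefix may be
  taken as long as possible, since moving letters from \<open>v\<close> to \<open>u\<close>
  preserves the condition by \<open>gp_append\<close>. For \<open>n \<le> i\<close> the suffix is
  empty and the condition is vacuous.\<close>

definition stratum :: "'a list \<Rightarrow> 'a \<Rightarrow> nat \<Rightarrow> nat \<Rightarrow> 'a list set" where
  "stratum a e i n = {w \<in> gp_words X G a n. gp (drop i w) (take i w @ e # a)}"

lemma delete_nth_in_stratum:
  assumes "u @ v \<in> stratum a e (Suc j) (Suc n)" "length u = Suc j" "k \<le> j" "set a \<subseteq> X" "e \<in> X"
  shows "take k u @ drop (Suc k) u @ v \<in> stratum a e j n"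
proof -
  let ?u = "take k u @ drop (Suc k) u"
  have sub: "mset ?u \<subseteq># mset u"
    by (rule mset_delete_nth_subset)
  then have set_u: "set ?u \<subseteq> set u"
    by (metis set_mset_mono set_mset_mset)
  have len: "length ?u = j"
    using assms by auto
  have split_at: "take j (x @ v) = x \<and> drop j (x @ v) = v" if "length x = j" for x
    using that by auto
  have uv: "set u \<subseteq> X" "set v \<subseteq> X" "length (u @ v) = Suc n" "gp (u @ v) a" "gp v (u @ e # a)"
    using assms by (auto simp: stratum_def gp_words_def)
  have len_uv: "length (?u @ v) = n"
    using len uv(3) assms(2) by (simp only: length_append)
  have "gp (?u @ v) a"
    by (rule gp_mono[OF uv(4)]) (use sub uv assms in auto)
  moreover have "gp v (?u @ e # a)"
    by (rule gp_mono[OF uv(5)]) (use sub uv assms in auto)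
  moreover have "take j (?u @ v) = ?u" "drop j (?u @ v) = v"
    using split_at[OF len] by blast+
  ultimately have "?u @ v \<in> stratum a e j n"
    using len_uv uv set_u unfolding stratum_def gp_words_def by auto
  then show ?thesis by simp
qed

text \<open>Modulo \<open>T_j\<close> the differential acts only on the coefficient of
  \<open>u\<close>, up to sign: deleting a letter of \<open>u\<close> leaves a prefix of length
  \<open>j\<close>.\<close>

lemma keys_differential_prepend_stratum:
  assumes "length u = Suc j" "set a \<subseteq> X" "e \<in> X"
    and "\<And>v. v \<in> Poly_Mapping.keys c \<Longrightarrow> u @ v \<in> stratum a e (Suc j) (Suc n)"
  shows "Poly_Mapping.keys (word_differential (prepend u c) -
      frag_cmul ((-1) ^ Suc j) (prepend u (word_differential c))) \<subseteq> stratum a e j n"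
proof
  fix w assume "w \<in> Poly_Mapping.keys (word_differential (prepend u c) -
      frag_cmul ((-1) ^ Suc j) (prepend u (word_differential c)))"
  then obtain k v where "k < Suc j" "v \<in> Poly_Mapping.keys c" "w = take k u @ drop (Suc k) u @ v"
    using keys_differential_prepend[of u c] assms(1) by auto
  then show "w \<in> stratum a e j n"
    using delete_nth_in_stratum[of u v a e j n k] assms by auto
qed

lemma append_in_stratum:
  assumes "gp u a" "set u \<subseteq> X" "set a \<subseteq> X" "e \<in> X" "v \<in> gp_words X G (u @ e # a) n"
  shows "u @ v \<in> stratum a e (length u) (length u + n)"
proof -
  have v: "set v \<subseteq> X" "length v = n" "gp v (u @ e # a)"
    using assms(5) by (auto simp: gp_words_def)
  have "gp v (u @ a)"
    by (rule gp_mono[OF v(3)]) (use v assms in auto)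
  then have "gp (u @ v) a"
    using gp_append[of u v a] assms v by auto
  then show ?thesis
    using v assms by (auto simp: stratum_def gp_words_def)
qed

text \<open>The suffix after position \<open>j\<close> is already in general position to everything
  before it, so the chain rule leaves only a condition on the letter at \<open>j\<close>. Hence
  membership in \<open>T_j\<close> depends on the prefix alone.\<close>

lemma stratum_Suc_cases:
  assumes w: "w \<in> stratum a e (Suc j) n" and "j < n" "set a \<subseteq> X" "e \<in> X"
  shows "w \<in> stratum a e j n \<longleftrightarrow> gp [w ! j] (take j w @ e # a)"
proof -
  have len: "j < length w" and wX: "set w \<subseteq> X"
    using assms by (auto simp: stratum_def gp_words_def)
  define v where "v = drop (Suc j) w"
  have drop_j: "drop j w = [w ! j] @ v" and take_Suc: "take (Suc j) w = take j w @ [w ! j]"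
    using len by (simp_all add: Cons_nth_drop_Suc take_Suc_conv_app_nth v_def)
  have sets: "set v \<subseteq> X" "set (take j w) \<subseteq> X" "w ! j \<in> X"
    using wX len by (auto simp: v_def dest: in_set_dropD in_set_takeD)
  have "gp v (take (Suc j) w @ e # a)"
    using w by (simp add: stratum_def v_def)
  then have "gp v ([w ! j] @ take j w @ e # a)"
    by (rule gp_mono) (use sets assms in \<open>auto simp: take_Suc\<close>)
  then have "gp (drop j w) (take j w @ e # a) \<longleftrightarrow> gp [w ! j] (take j w @ e # a)"
    unfolding drop_j using gp_append[of "[w ! j]" v "take j w @ e # a"] sets assms by auto
  then show ?thesis
    using w by (simp add: stratum_def)
qed

section \<open>Pushing a cycle down one step of the filtration\<close>

text \<open>The coefficients of \<open>z\<close> at prefixes outside \<open>T_j\<close> are cycles;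
  filling each one and prepending its prefix gives a chain whose boundary agrees with
  \<open>z\<close> modulo \<open>T_j\<close>.\<close>

lemma cycle_descends:
  assumes aX: "set a \<subseteq> X" and eX: "e \<in> X"
    and acyclic: "\<And>u z. length u = Suc j \<Longrightarrow> set u \<subseteq> X \<Longrightarrow>
        Poly_Mapping.keys z \<subseteq> gp_words X G (u @ e # a) n \<Longrightarrow> word_differential z = 0 \<Longrightarrow>
        \<exists>c. Poly_Mapping.keys c \<subseteq> gp_words X G (u @ e # a) (Suc n) \<and> word_differential c = z"
    and z: "Poly_Mapping.keys z \<subseteq> stratum a e (Suc j) (Suc j + n)" and dz: "word_differential z = 0"
  shows "\<exists>c. Poly_Mapping.keys c \<subseteq> gp_words X G a (Suc (Suc j + n)) \<and>
      Poly_Mapping.keys (z - word_differential c) \<subseteq> stratum a e j (Suc j + n)"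
proof -
  define T where "T = stratum a e (Suc j) (Suc j + n)"
  define s :: int where "s = (-1) ^ Suc j"
  have ss: "s * s = 1"
    by (simp add: s_def flip: power_add)
  \<comment> \<open>The bad prefixes index the summands of \<open>T_{j+1} / T_j\<close>.\<close>
  define bad where "bad u \<longleftrightarrow> length u = Suc j \<and> \<not> gp [u ! j] (take j u @ e # a)" for u
  have T_cases: "w \<in> stratum a e j (Suc j + n) \<longleftrightarrow> \<not> bad (take (Suc j) w)" if "w \<in> T" for w
    using stratum_Suc_cases[of w a e j "Suc j + n"] that aX eX
    by (auto simp: bad_def T_def stratum_def gp_words_def min_def)
  \<comment> \<open>This concerns boundaries, one degree lower. For \<open>n = 0\<close> such words
    have length \<open>j\<close>, too short to have a bad prefix.\<close>
  have not_bad: "take (Suc j) w \<noteq> u" if "w \<in> stratum a e j (j + n)" "bad u" for w u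
  proof
    assume eq: "take (Suc j) w = u"
    have w: "set w \<subseteq> X" "gp (drop j w) (take j w @ e # a)"
      using that by (auto simp: stratum_def gp_words_def)
    have len: "j < length w"
      using eq that(2) by (auto simp: bad_def)
    have "gp [w ! j] (take j w @ e # a)"
      by (rule gp_mono[OF w(2)])
        (use w len aX eX in \<open>auto simp: Cons_nth_drop_Suc[symmetric] dest: in_set_dropD in_set_takeD\<close>)
    then show False
      using that(2) eq by (auto simp: bad_def)
  qed
  have split: "length (take (Suc j) w) = Suc j" "set (take (Suc j) w) \<subseteq> X"
    "gp (take (Suc j) w) a" "drop (Suc j) w \<in> gp_words X G (take (Suc j) w @ e # a) n"
    if "w \<in> T" for w
  proof -
    have w: "set w \<subseteq> X" "length w = Suc j + n" "gp w a"
      "gp (drop (Suc j) w) (take (Suc j) w @ e # a)"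
      using that by (auto simp: T_def stratum_def gp_words_def)
    have sub: "mset (take (Suc j) w) \<subseteq># mset w"
      by (metis append_take_drop_id mset_append mset_subset_eq_add_left)
    show "length (take (Suc j) w) = Suc j"
      using w by simp
    show "set (take (Suc j) w) \<subseteq> X"
      using w by (auto dest: in_set_takeD)
    show "gp (take (Suc j) w) a"
      by (rule gp_mono[OF w(3) sub]) (use w aX in auto)
    show "drop (Suc j) w \<in> gp_words X G (take (Suc j) w @ e # a) n"
      using w by (auto simp: gp_words_def dest: in_set_dropD)
  qed
  \<comment> \<open>The error term of the Leibniz rule lies in \<open>T_j\<close>, where no bad
    prefix occurs, so taking a bad coefficient commutes with the differential up to
    \<open>s\<close>.\<close>
  have coeff_d: "frag_cmul s (word_differential (prefix_coeff u c)) = prefix_coeff u (word_differential c)"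
    if u: "bad u" and "Poly_Mapping.keys c \<subseteq> T" for u c
    using that(2)
  proof (induction c rule: frag_induction)
    case (one w)
    define u' v where "u' = take (Suc j) w" and "v = drop (Suc j) w"
    have w: "w = u' @ v" and len: "length u = Suc j" "length u' = Suc j"
      using u split[OF one] by (simp_all add: u'_def v_def bad_def)
    define R where "R = word_differential (frag_of w) - frag_cmul s (prepend u' (word_differential (frag_of v)))"
    have "Poly_Mapping.keys R \<subseteq> stratum a e j (j + n)"
      using keys_differential_prepend_stratum[of u' j a e "frag_of v" "j + n"] len aX eX one
      by (simp add: R_def s_def w T_def keys_frag_of)
    then have "prefix_coeff u R = 0"
      using not_bad[OF _ u] len by (intro prefix_coeff_eq_0) auto
    then have "prefix_coeff u (word_differential (frag_of w)) =
        frag_cmul s (if u = u' then word_differential (frag_of v) else 0)"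
      using len by (simp add: R_def prefix_coeff_diff prefix_coeff_cmul prefix_coeff_prepend)
    then show ?case
      using len by (auto simp: prefix_coeff_frag_of w)
  qed (simp_all add: prefix_coeff_diff word_differential_diff 
      frag_cmul_diff_right)
  define U where "U = {u \<in> take (Suc j) ` Poly_Mapping.keys z. bad u}"
  have U: "finite U" "\<And>u. u \<in> U \<Longrightarrow> bad u \<and> length u = Suc j \<and> set u \<subseteq> X \<and> gp u a"
    using z split by (auto simp: U_def T_def)
  have rest: "Poly_Mapping.keys (z - (\<Sum>u\<in>U. prepend u (prefix_coeff u z))) \<subseteq> stratum a e j (Suc j + n)"
  proof -
    have "Poly_Mapping.keys c \<subseteq> Poly_Mapping.keys z \<Longrightarrow>
      Poly_Mapping.keys (c - (\<Sum>u\<in>U. prepend u (prefix_coeff u c))) \<subseteq> stratum a e j (Suc j + n)" for c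
    proof (induction c rule: frag_induction)
      case (one w)
      let ?u = "take (Suc j) w"
      \<comment> \<open>A single word contributes to the coefficient of its own prefix only, so it
        is either cancelled or, having a good prefix, already in \<open>T_j\<close>.\<close>
      have "(\<Sum>u\<in>U. prepend u (prefix_coeff u (frag_of w))) = (\<Sum>u\<in>U. if u = ?u then frag_of w else 0)"
        using U(2) by (intro sum.cong) (auto simp: prefix_coeff_frag_of simp del: length_take)
      also have "\<dots> = (if ?u \<in> U then frag_of w else 0)"
        using U(1) by simp
      finally show ?case
        using one T_cases[of w] z by (auto simp: U_def T_def keys_frag_of)
    next
      case (diff c c')
      have "c - c' - (\<Sum>u\<in>U. prepend u (prefix_coeff u (c - c'))) =
          (c - (\<Sum>u\<in>U. prepend u (prefix_coeff u c))) - (c' - (\<Sum>u\<in>U. prepend u (prefix_coeff u c')))"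
        by (simp add: prefix_coeff_diff prepend_diff sum_subtractf)
      then show ?case
        using diff order_trans[OF keys_diff Un_least] by (simp only:)
    qed simp
    then show ?thesis by blast
  qed
  have "\<exists>c. Poly_Mapping.keys c \<subseteq> gp_words X G (u @ e # a) (Suc n) \<and>
      word_differential c = prefix_coeff u z" if u: "u \<in> U" for u
  proof (rule acyclic)
    show "length u = Suc j" "set u \<subseteq> X"
      using U(2)[OF u] by auto
    have "frag_cmul s (word_differential (prefix_coeff u z)) = 0"
      using coeff_d[of u z] U(2)[OF u] z dz by (simp add: T_def)
    then show "word_differential (prefix_coeff u z) = 0"
      by (simp add: s_def)
    show "Poly_Mapping.keys (prefix_coeff u z) \<subseteq> gp_words X G (u @ e # a) n"
    proof
      fix v assume "v \<in> Poly_Mapping.keys (prefix_coeff u z)"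
      then have "u @ v \<in> T"
        using keys_prefix_coeff z by (auto simp: T_def)
      then show "v \<in> gp_words X G (u @ e # a) n"
        using split(4)[of "u @ v"] U(2)[OF u] by simp
    qed
  qed
  then obtain f where f: "\<And>u. u \<in> U \<Longrightarrow> Poly_Mapping.keys (f u) \<subseteq> gp_words X G (u @ e # a) (Suc n)"
    "\<And>u. u \<in> U \<Longrightarrow> word_differential (f u) = prefix_coeff u z"
    by metis
  have in_T: "u @ v \<in> stratum a e (Suc j) (Suc (Suc j + n))" if "u \<in> U" "v \<in> Poly_Mapping.keys (f u)" for u v
    using append_in_stratum[of u a e v "Suc n"] f(1) that U(2)[OF that(1)] aX eX by auto
  \<comment> \<open>The factor \<open>s\<close> undoes the sign produced by moving the differential
    past \<open>u\<close>, as \<open>s * s = 1\<close>.\<close>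
  define C where "C = (\<Sum>u\<in>U. frag_cmul s (prepend u (f u)))"
  define R where "R u = word_differential (prepend u (f u)) -
      frag_cmul ((-1) ^ Suc j) (prepend u (word_differential (f u)))" for u
  have R: "Poly_Mapping.keys (R u) \<subseteq> stratum a e j (Suc j + n)" if "u \<in> U" for u
    unfolding R_def
    by (rule keys_differential_prepend_stratum) (use U(2)[OF that] in_T[OF that] aX eX in auto)
  have "Poly_Mapping.keys C \<subseteq> gp_words X G a (Suc (Suc j + n))"
    unfolding C_def
  proof (rule order_trans[OF keys_sum], rule UN_least)
    fix u assume "u \<in> U"
    show "Poly_Mapping.keys (frag_cmul s (prepend u (f u))) \<subseteq> gp_words X G a (Suc (Suc j + n))"
      using in_T[OF \<open>u \<in> U\<close>] keys_prepend[of u "f u"] keys_cmul[of s "prepend u (f u)"]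
      unfolding stratum_def by blast
  qed
  moreover have "Poly_Mapping.keys (z - word_differential C) \<subseteq> stratum a e j (Suc j + n)"
  proof -
    have "word_differential C = (\<Sum>u\<in>U. frag_cmul s (word_differential (prepend u (f u))))"
      using U(1) by (simp add: C_def word_differential_sum word_differential_cmul)
    also have "\<dots> = (\<Sum>u\<in>U. prepend u (prefix_coeff u z) + frag_cmul s (R u))"
    proof (rule sum.cong)
      fix u assume "u \<in> U"
      then have "word_differential (prepend u (f u)) = R u + frag_cmul s (prepend u (prefix_coeff u z))"
        by (simp add: R_def s_def f(2))
      then show "frag_cmul s (word_differential (prepend u (f u))) =
          prepend u (prefix_coeff u z) + frag_cmul s (R u)"
        by (simp add: frag_cmul_distrib2 ss)
    qed simp
    finally have "z - word_differential C =
        (z - (\<Sum>u\<in>U. prepend u (prefix_coeff u z))) - (\<Sum>u\<in>U. frag_cmul s (R u))"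
      by (simp add: sum.distrib)
    moreover have "Poly_Mapping.keys (\<Sum>u\<in>U. frag_cmul s (R u)) \<subseteq> stratum a e j (Suc j + n)"
      using R by (intro order_trans[OF keys_sum]) (auto dest!: subsetD[OF keys_cmul])
    ultimately show ?thesis
      using rest order_trans[OF keys_diff Un_least] by (simp only:)
  qed
  ultimately show ?thesis by blast
qed

section \<open>Vanishing by induction on the degree\<close>

lemma cycle_is_boundary:
  assumes "set a \<subseteq> X" "enat (2 * m + length a + 1) \<le> gp_size X G"
    and "Poly_Mapping.keys z \<subseteq> gp_words X G a m" "word_differential z = 0"
  shows "\<exists>c. Poly_Mapping.keys c \<subseteq> gp_words X G a (Suc m) \<and> word_differential c = z"
  using assms
proof (induction m arbitrary: a z rule: less_induct)
  case (less m)
  note aX = less.prems(1) and size = less.prems(2)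
  \<comment> \<open>Otherwise \<open>a\<close> itself would bound \<open>gp_size X G\<close> by
    \<open>length a\<close>.\<close>
  have "\<exists>e\<in>X. gp [e] a"
  proof (rule ccontr)
    assume "\<not> ?thesis"
    then have "gp_size X G \<le> enat (length a)"
      unfolding gp_size_def using aX by (intro Inf_lower) auto
    then have "enat (2 * m + length a + 1) \<le> enat (length a)"
      using size by (rule order_trans[rotated])
    then show False by simp
  qed
  then obtain e where e: "e \<in> X" "gp [e] a" by blast
  \<comment> \<open>Descent from \<open>T_m\<close> to \<open>T_0\<close>; \<open>k\<close> counts
    the steps done and is also the degree of the coefficients in the next step.\<close>
  have "\<exists>c. Poly_Mapping.keys c \<subseteq> gp_words X G a (Suc m) \<and>
      Poly_Mapping.keys (z - word_differential c) \<subseteq> stratum a e (m - k) m" if "k \<le> m" for k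
    using that
  proof (induction k)
    case 0
    have "gp_words X G a m \<subseteq> stratum a e m m"
      by (auto simp: stratum_def gp_words_def in_general_position_def)
    then show ?case
      using less.prems(3) by (intro exI[of _ 0]) auto
  next
    case (Suc k)
    define j where "j = m - Suc k"
    have mk: "m - k = Suc j" "m = Suc j + k" "m - Suc k = j"
      using Suc.prems by (auto simp: j_def)
    obtain c where c: "Poly_Mapping.keys c \<subseteq> gp_words X G a (Suc m)"
      "Poly_Mapping.keys (z - word_differential c) \<subseteq> stratum a e (m - k) m"
      using Suc by auto
    have "\<exists>c'. Poly_Mapping.keys c' \<subseteq> gp_words X G a (Suc (Suc j + k)) \<and>
        Poly_Mapping.keys (z - word_differential c - word_differential c') \<subseteq> stratum a e j (Suc j + k)"
    proof (rule cycle_descends[OF aX e(1)])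
      show "Poly_Mapping.keys (z - word_differential c) \<subseteq> stratum a e (Suc j) (Suc j + k)"
        using c(2) mk by simp
      show "word_differential (z - word_differential c) = 0"
        using less.prems(4) by (simp add: word_differential_diff word_differential_square)
      fix u y
      assume u: "length u = Suc j" "set u \<subseteq> X"
        and y: "Poly_Mapping.keys y \<subseteq> gp_words X G (u @ e # a) k" "word_differential y = 0"
      \<comment> \<open>With \<open>m = j + 1 + k\<close>, the doubled degree drops by
        \<open>2 * (j + 1)\<close> while the sequence grows by \<open>j + 2\<close>.\<close>
      have "enat (2 * k + length (u @ e # a) + 1) \<le> enat (2 * m + length a + 1)"
        using u mk by simp
      then have "enat (2 * k + length (u @ e # a) + 1) \<le> gp_size X G"
        using size by (rule order_trans)
      then show "\<exists>c. Poly_Mapping.keys c \<subseteq> gp_words X G (u @ e # a) (Suc k) \<and> word_differential c = y"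
        by (rule less.IH[rotated 2]) (use u y aX e mk in auto)
    qed
    then obtain c' where c': "Poly_Mapping.keys c' \<subseteq> gp_words X G a (Suc m)"
      "Poly_Mapping.keys (z - word_differential c - word_differential c') \<subseteq> stratum a e (m - Suc k) m"
      unfolding mk(3) mk(2)[symmetric] by blast
    have "Poly_Mapping.keys (c + c') \<subseteq> gp_words X G a (Suc m)"
      using c(1) c'(1) keys_add[of c c'] by blast
    then show ?case
      using c'(2) by (intro exI[of _ "c + c'"]) (simp add: word_differential_add diff_diff_eq)
  qed
  from this[of m] obtain c where c: "Poly_Mapping.keys c \<subseteq> gp_words X G a (Suc m)"
    "Poly_Mapping.keys (z - word_differential c) \<subseteq> stratum a e 0 m"
    by auto
  \<comment> \<open>\<open>y\<close> lies in \<open>T_0\<close>, so prepending \<open>e\<close>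
    stays inside \<open>F_G(X;a)\<close>, and the homotopy formula makes the cycle \<open>y\<close>
    a boundary there.\<close>
  define y where "y = z - word_differential c"
  have "word_differential y = 0"
    using less.prems(4) by (simp add: y_def word_differential_diff word_differential_square)
  then have dy: "word_differential (prepend [e] y) = y"
    by (simp add: word_differential_prepend_single)
  have "[e] @ w \<in> gp_words X G a (Suc m)" if "w \<in> Poly_Mapping.keys y" for w
  proof -
    have "w \<in> stratum a e 0 m"
      using c(2) that by (auto simp: y_def)
    then show ?thesis
      using gp_append[of "[e]" w a] e aX by (auto simp: stratum_def gp_words_def)
  qed
  then have "Poly_Mapping.keys (prepend [e] y) \<subseteq> gp_words X G a (Suc m)"
    using keys_prepend[of "[e]" y] by blast
  then have "Poly_Mapping.keys (c + prepend [e] y) \<subseteq> gp_words X G a (Suc m)"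
    using c(1) keys_add[of c "prepend [e] y"] by blast
  moreover have "word_differential (c + prepend [e] y) = z"
    by (simp add: word_differential_add dy) (simp add: y_def)
  ultimately show ?case by blast
qed

end

section \<open>From chains to the homology group\<close>

lemma (in group) trivial_group_Mod_carrier: "trivial_group (G Mod carrier G)"
proof -
  interpret normal "carrier G" G
    by (rule normal_self)
  have "carrier (G Mod carrier G) = {carrier G}"
    by (auto simp: carrier_FactGroup coset_join2 subgroup_self)
  then show ?thesis
    by (simp add: trivial_group_def factorgroup_is_group)
qed

theorem theorem3:
  fixes X :: "'a set" and G :: "'a list \<Rightarrow> 'a list \<Rightarrow> bool" and a :: "'a list" and m :: nat
  assumes "X \<noteq> {}"
    and "general_position_relation X G"
    and "set a \<subseteq> X"
    and "ereal (real m) \<le> (ereal_of_enat (gp_size X G) - ereal (real (length a)) - 1) / 2"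
  shows "trivial_group (gp_homology_group X G a m)"
proof -
  interpret general_position X G
    by unfold_locales (fact assms(2))
  let ?A = "gp_chain_group X G a m"
  \<comment> \<open>The real inequality becomes one between natural numbers; for infinite
    \<open>gp_size X G\<close> it holds trivially.\<close>
  have size: "enat (2 * m + length a + 1) \<le> gp_size X G"
  proof (cases "gp_size X G")
    case (enat n)
    then have "real m \<le> (real n - real (length a) - 1) / 2"
      using assms(4) by (simp add: one_ereal_def numeral_eq_ereal)
    then show ?thesis
      using enat by simp
  qed simp
  have eq: "gp_boundaries X G a m = gp_cycles X G a m"
  proof
    show "gp_boundaries X G a m \<subseteq> gp_cycles X G a m"
    proof
      fix z assume "z \<in> gp_boundaries X G a m"
      then obtain c where "Poly_Mapping.keys c \<subseteq> gp_words X G a (Suc m)" "z = word_differential c"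
        by (auto simp: gp_boundaries_def gp_chain_group_def)
      then show "z \<in> gp_cycles X G a m"
        using keys_differential_gp_words[OF assms(3)]
        by (simp add: gp_cycles_def gp_chain_group_def word_differential_square)
    qed
    show "gp_cycles X G a m \<subseteq> gp_boundaries X G a m"
    proof
      fix z assume "z \<in> gp_cycles X G a m"
      then obtain c where "Poly_Mapping.keys c \<subseteq> gp_words X G a (Suc m)" "word_differential c = z"
        using cycle_is_boundary[OF assms(3) size, of z]
        by (auto simp: gp_cycles_def gp_chain_group_def)
      then show "z \<in> gp_boundaries X G a m"
        by (auto simp: gp_boundaries_def gp_chain_group_def)
    qed
  qed
  interpret A: group ?A
    by (simp add: gp_chain_group_def)
  \<comment> \<open>Since the cycles form a subgroup, the subgroup they generate has no further
    elements, and the quotient is that of a group by its whole carrier.\<close>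
  have "subgroup (gp_cycles X G a m) ?A"
  proof (rule A.subgroupI)
    have "0 \<in> gp_cycles X G a m"
      by (simp add: gp_cycles_def gp_chain_group_def)
    then show "gp_cycles X G a m \<noteq> {}" by blast
    fix x y assume x: "x \<in> gp_cycles X G a m" and y: "y \<in> gp_cycles X G a m"
    have "word_differential (- x) = - word_differential x"
      using word_differential_diff[of 0 x] by simp
    then show "inv\<^bsub>?A\<^esub> x \<in> gp_cycles X G a m"
      using x by (simp add: gp_cycles_def gp_chain_group_def)
    show "x \<otimes>\<^bsub>?A\<^esub> y \<in> gp_cycles X G a m"
      using x y keys_add[of x y] by (auto simp: gp_cycles_def gp_chain_group_def word_differential_add)
  qed (auto simp: gp_cycles_def)
  then have "carrier (subgroup_generated ?A (gp_cycles X G a m)) = gp_cycles X G a m"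
    by (rule subgroup.carrier_subgroup_generated_subgroup)
  then show ?thesis
    unfolding gp_homology_group_def eq
    using group.trivial_group_Mod_carrier[OF A.group_subgroup_generated] by metis
qed

end
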